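(* Let $K \subset \mathbb{R}^d$ be compact. Suppose that for any $d(d+3)/2$ points in $K$ there is an ellipsoid of volume $1$ such that every point in the ellipsoid sees all $d(d+3)/2$ points. Then there is an ellipsoid of volume $1$ such that every point in the ellipsoid sees all of $K$.
   Context: For $K \subset \mathbb{R}^d$ and $x,y \in K$, $x$ sees $y$ if the closed segment $[x,y]$ is contained in $K$. An ellipsoid is a set $a + XB_d$ with $a \in \mathbb{R}^d$, $X$ a nonsingular $d\times d$ matrix and $B_d$ the closed unit ball; ellipsoids are solid. *)

theory Defs
  imports "HOL-Analysis.Analysis"
begin

(* The segment contains its endpoints, so this forces x and y to lie in K. *)
definition sees :: "'a::real_vector set \<Rightarrow> 'a \<Rightarrow> 'a \<Rightarrow> bool" where
  "sees K x y \<longleftrightarrow> closed_segment x y \<subseteq> K"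

definition ellipsoid :: "(real ^ 'd) set \<Rightarrow> bool" where
  "ellipsoid E \<longleftrightarrow>
     (\<exists>a (X :: real ^ 'd ^ 'd). invertible X \<and> E = (\<lambda>v. a + X *v v) ` cball 0 1)"

end

theory Submission
  imports Defs
begin

text \<open>Every ellipsoid is \<open>a + L B\<close> with \<open>B\<close> the unit ball and \<open>L\<close> lower triangular with positive
  diagonal (QR decomposition), so ellipsoids form a set of dimension \<open>d (d + 3) / 2\<close>. Those of volume
  at least 1 inside a convex body \<open>C\<close> form a convex set, because the condition \<open>a + L B \<subseteq> C\<close> is convex
  and the product of the diagonal entries is log-concave. Shrinking the last diagonal entry only
  shrinks the ellipsoid, so that entry can be projected out, and Helly's theorem in dimension
  \<open>d (d + 3) / 2 - 1\<close> gives the Helly number \<open>d (d + 3) / 2\<close> for ellipsoids of volume 1. As in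
  Krasnoselskii's theorem, this is applied to the convex hulls of the sets of points that see a
  given point of \<open>K\<close>, the intersection of which is the kernel of \<open>K\<close>.\<close>

section \<open>Helly's theorem in a subspace\<close>

text \<open>Induction on the size of the family, with Radon's theorem for the step. Measuring by
  \<open>dim V\<close> instead of the ambient dimension lets the bound be tuned to a subspace of
  matrices.\<close>

lemma Helly_dim_finite:
  fixes C :: "'i \<Rightarrow> 'a::euclidean_space set"
  assumes "finite I" "dim V \<le> k"
    and "\<And>i. i \<in> I \<Longrightarrow> convex (C i)" "\<And>i. i \<in> I \<Longrightarrow> C i \<subseteq> V"
    and "\<And>J. J \<subseteq> I \<Longrightarrow> card J \<le> k + 1 \<Longrightarrow> (\<Inter>i\<in>J. C i) \<noteq> {}"
  shows "(\<Inter>i\<in>I. C i) \<noteq> {}"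
  using assms
proof (induction "card I" arbitrary: I rule: less_induct)
  case less
  show ?case
  proof (cases "card I \<le> k + 1")
    case True
    then show ?thesis using less.prems by blast
  next
    case False
    have "\<exists>x. x \<in> (\<Inter>j\<in>I - {i}. C j)" if "i \<in> I" for i
    proof -
      have "(\<Inter>j\<in>I - {i}. C j) \<noteq> {}"
      proof (rule less.hyps)
        show "card (I - {i}) < card I"
          using less.prems(1) that by (rule card_Diff1_less)
        show "(\<Inter>j\<in>J. C j) \<noteq> {}" if "J \<subseteq> I - {i}" "card J \<le> k + 1" for J
          using less.prems(5) that by blast
      qed (use less.prems in auto)
      then show ?thesis by blast
    qed
    \<comment> \<open>The point \<open>q i\<close> lies in every set of the family except possibly
      \<open>C i\<close>.\<close>
    then obtain q where q: "\<And>i j. i \<in> I \<Longrightarrow> j \<in> I \<Longrightarrow> j \<noteq> i \<Longrightarrow> q i \<in> C j"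
      by (metis (no_types, lifting) DiffI INT_E singletonD)
    show ?thesis
    proof (cases "inj_on q I")
      case False
      \<comment> \<open>A point shared by two indices lies in all sets: for each \<open>j\<close>,
        one of the two indices differs from \<open>j\<close>.\<close>
      then obtain i i' where i: "i \<in> I" "i' \<in> I" "i \<noteq> i'" "q i = q i'"
        by (auto simp: inj_on_def)
      have "q i \<in> C j" if "j \<in> I" for j
        using q[of i j] q[of i' j] i that by (cases "j = i") auto
      then show ?thesis by blast
    next
      case True
      have qV: "q ` I \<subseteq> V"
      proof
        fix x assume "x \<in> q ` I"
        then obtain i where i: "i \<in> I" "x = q i" by blast
        have "card (I - {i}) \<noteq> 0"
          using False i less.prems(1) by (simp add: card_Diff_singleton)
        then obtain j where "j \<in> I" "j \<noteq> i"
          by (metis Diff_iff all_not_in_conv card.empty singletonI)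
        with q i less.prems(4) show "x \<in> V" by blast
      qed
      have "dim (q ` I) \<le> k"
        using dim_subset[OF qV] less.prems(2) by linarith
      moreover have "card (q ` I) \<ge> k + 2"
        using True False by (simp add: card_image)
      ultimately have "affine_dependent (q ` I)"
        using less.prems(1) by (intro affine_dependent_biggerset_general) auto
      then obtain M N where MN: "M \<inter> N = {}" "M \<union> N = q ` I"
          "(convex hull M) \<inter> (convex hull N) \<noteq> {}"
        using Radon_partition[of "q ` I"] less.prems(1) by auto
      then obtain x where x: "x \<in> convex hull M" "x \<in> convex hull N" by blast
      \<comment> \<open>As \<open>M\<close> and \<open>N\<close> are disjoint, one of them misses
        \<open>q j\<close>. All its points are then \<open>q i\<close> with \<open>i\<close>
        different from \<open>j\<close>, so its hull, which contains \<open>x\<close>, lies in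
        \<open>C j\<close>.\<close>
      have "x \<in> C j" if j: "j \<in> I" for j
      proof (cases "q j \<in> M")
        case True
        have "N \<subseteq> C j"
        proof
          fix z assume "z \<in> N"
          then obtain i where "i \<in> I" "z = q i" "z \<notin> M" using MN(1,2) by blast
          with True q[of i j] j show "z \<in> C j" by (cases "j = i") auto
        qed
        then show ?thesis
          using x(2) less.prems(3)[OF j] by (meson hull_minimal subsetD)
      next
        case False
        have "M \<subseteq> C j"
        proof
          fix z assume "z \<in> M"
          then obtain i where "i \<in> I" "z = q i" using MN(2) by blast
          with False \<open>z \<in> M\<close> q[of i j] j show "z \<in> C j" by (cases "j = i") auto
        qed
        then show ?thesis
          using x(1) less.prems(3)[OF j] by (meson hull_minimal subsetD)
      qed
      then show ?thesis by blast
    qed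
  qed
qed

text \<open>Finite intersection property: \<open>i0\<close> is added to every finite subfamily, and
  its set is the compact set inside which the intersections are taken.\<close>

lemma Helly_dim_compact:
  fixes C :: "'i \<Rightarrow> 'a::euclidean_space set"
  assumes "dim V \<le> k"
    and "\<And>i. i \<in> I \<Longrightarrow> convex (C i)" "\<And>i. i \<in> I \<Longrightarrow> compact (C i)" 
      "\<And>i. i \<in> I \<Longrightarrow> C i \<subseteq> V"
    and "\<And>J. finite J \<Longrightarrow> J \<subseteq> I \<Longrightarrow> card J \<le> k + 1 \<Longrightarrow> (\<Inter>i\<in>J. C i) \<noteq> {}"
  shows "(\<Inter>i\<in>I. C i) \<noteq> {}"
proof (cases "I = {}")
  case False
  then obtain i0 where i0: "i0 \<in> I" by blast
  have "C i0 \<inter> \<Inter> (C ` I) \<noteq> {}"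
  proof (rule compact_imp_fip_image)
    fix J assume J: "finite J" "J \<subseteq> I"
    have "(\<Inter>i\<in>insert i0 J. C i) \<noteq> {}"
    proof (rule Helly_dim_finite[OF _ assms(1)])
      show "(\<Inter>i\<in>L. C i) \<noteq> {}" if "L \<subseteq> insert i0 J" "card L \<le> k + 1" for L
        using that J i0 by (intro assms(5) finite_subset[OF that(1)]) auto
      show "finite (insert i0 J)" using J by simp
      fix i assume "i \<in> insert i0 J"
      then have "i \<in> I" using J i0 by blast
      then show "convex (C i)" "C i \<subseteq> V" using assms(2,4) by blast+
    qed
    then show "C i0 \<inter> \<Inter> (C ` J) \<noteq> {}" by simp
  next
    show "compact (C i0)" using i0 by (rule assms(3))
    show "closed (C i)" if "i \<in> I" for i using assms(3)[OF that] by (rule compact_imp_closed)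
  qed
  then show ?thesis by blast
qed simp

section \<open>The kernel of a closed set\<close>

text \<open>If a point \<open>z\<close> of the segment from \<open>y\<close> to \<open>x\<close> is missing from \<open>K\<close>, move a small ball disjoint
  from \<open>K\<close> from \<open>z\<close> towards \<open>x\<close> until it first touches \<open>K\<close>, at \<open>k\<close> say. Its tangent hyperplane at
  \<open>k\<close> separates \<open>y\<close> from all points that see \<open>k\<close>.\<close>

lemma krasnoselskii_kernel:
  fixes K :: "'a::euclidean_space set"
  assumes "closed K" and y: "\<And>x. x \<in> K \<Longrightarrow> y \<in> convex hull {z. sees K z x}" and "x \<in> K"
  shows "sees K y x"
proof (rule ccontr)
  assume "\<not> sees K y x"
  then obtain z where z: "z \<in> closed_segment y x" "z \<notin> K" by (auto simp: sees_def)
  define \<delta> where "\<delta> = infdist z K"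
  have K: "K \<noteq> {}" using \<open>x \<in> K\<close> by blast
  have \<delta>: "\<delta> > 0"
    using z K \<open>closed K\<close> unfolding \<delta>_def
    by (metis in_closed_iff_infdist_zero infdist_nonneg less_eq_real_def)
  \<comment> \<open>\<open>w\<close> runs from \<open>z\<close> at time 0 to \<open>x\<close> at
    time 1; \<open>S\<close> collects the times at which the ball of radius
    \<open>\<delta> / 2\<close> around \<open>w t\<close> meets \<open>K\<close>.\<close>
  define w where "w t = z + t *\<^sub>R (x - z)" for t
  define S where "S = {t \<in> {0..1}. infdist (w t) K \<le> \<delta> / 2}"
  have cont: "continuous_on A (\<lambda>t. infdist (w t) K)" for A
    unfolding w_def by (intro continuous_intros)
  have "S = {0..1} \<inter> {t. infdist (w t) K \<le> \<delta> / 2}" by (auto simp: S_def)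
  moreover have "closed {t. infdist (w t) K \<le> \<delta> / 2}"
    by (intro closed_Collect_le cont continuous_on_const)
  ultimately have "compact S" by (simp add: compact_Int_closed)
  moreover have "1 \<in> S"
    unfolding S_def w_def using \<open>x \<in> K\<close> \<delta> by (simp add: infdist_zero)
  ultimately obtain t where t: "t \<in> S" "\<And>s. s \<in> S \<Longrightarrow> t \<le> s"
    using compact_attains_inf[of S] by blast
  then have t01: "0 \<le> t" "t \<le> 1" and tle: "infdist (w t) K \<le> \<delta> / 2" by (auto simp: S_def)
  have tmin: "infdist (w s) K > \<delta> / 2" if "0 \<le> s" "s < t" for s
    using t(2)[of s] that t01 by (force simp: S_def)
  have "t \<noteq> 0"
    using tle \<delta> by (auto simp: w_def \<delta>_def)
  then have tpos: "t > 0" using t01 by simp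
  \<comment> \<open>By continuity the distance at the first time is exactly half of \<delta>, hence
    positive, which makes the normal \<open>e\<close> nonzero.\<close>
  obtain s where s: "0 \<le> s" "s \<le> t" "infdist (w s) K = \<delta> / 2"
    using IVT2'[of "\<lambda>s. infdist (w s) K" t "\<delta> / 2" 0, OF tle _ t01(1) cont] \<delta>
    by (auto simp: w_def \<delta>_def)
  then have "s = t" using tmin[of s] by force
  then have wt: "infdist (w t) K > 0" using s \<delta> by simp
  obtain k where k: "k \<in> K" "infdist (w t) K = dist (w t) k"
    using infdist_attains_inf[OF \<open>closed K\<close> K] by blast
  define e where "e = w t - k"
  have e: "e \<noteq> 0" using wt k by (auto simp: e_def)
  \<comment> \<open>From a point beyond the tangent hyperplane, the segment to \<open>k\<close>
    would contain points of \<open>K\<close> closer to \<open>w t\<close> than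
    \<open>k\<close>.\<close>
  have half: "{p. sees K p k} \<subseteq> {p. e \<bullet> p \<le> e \<bullet> k}"
  proof (clarify)
    fix p assume p: "sees K p k"
    show "e \<bullet> p \<le> e \<bullet> k"
    proof (rule ccontr)
      assume "\<not> e \<bullet> p \<le> e \<bullet> k"
      then have pos: "(w t - k) \<bullet> (p - k) > 0" by (simp add: e_def inner_diff_right)
      obtain u where u: "u > 0" "u \<le> 1" "dist (k + u *\<^sub>R (p - k)) (w t) < dist k (w t)"
        using closer_point_lemma[OF pos] by blast
      have "k + u *\<^sub>R (p - k) \<in> closed_segment k p"
        using u by (auto simp: in_segment algebra_simps intro!: exI[of _ u])
      then have "k + u *\<^sub>R (p - k) \<in> K"
        using p by (auto simp: sees_def closed_segment_commute)
      then have "infdist (w t) K \<le> dist (w t) (k + u *\<^sub>R (p - k))" by (rule infdist_le)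
      then show False using u(3) k(2) by (simp add: dist_commute)
    qed
  qed
  have "convex hull {p. sees K p k} \<subseteq> {p. e \<bullet> p \<le> e \<bullet> k}"
    using half convex_halfspace_le by (rule hull_minimal)
  then have ek: "e \<bullet> y \<le> e \<bullet> k" using y[OF k(1)] by blast
  \<comment> \<open>Otherwise moving back from \<open>w t\<close> towards \<open>z\<close> brings
    the centre closer to \<open>k\<close>, and the ball would have touched \<open>K\<close>
    earlier.\<close>
  have dir: "e \<bullet> (z - x) \<ge> 0"
  proof (rule ccontr)
    assume "\<not> e \<bullet> (z - x) \<ge> 0"
    then have "0 < t * (e \<bullet> (x - z))"
      using tpos by (simp add: inner_diff_right)
    also have "t * (e \<bullet> (x - z)) = (k - w t) \<bullet> (z - w t)"
      by (simp add: w_def e_def inner_diff_left inner_diff_right algebra_simps)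
    finally have "(k - w t) \<bullet> (z - w t) > 0" .
    then obtain u where u: "u > 0" "u \<le> 1" "dist (w t + u *\<^sub>R (z - w t)) k < dist (w t) k"
      using closer_point_lemma[of k "w t" z] by blast
    have "w t + u *\<^sub>R (z - w t) = w (t - u * t)" by (simp add: w_def algebra_simps)
    moreover have "0 \<le> t - u * t" "t - u * t < t" using u tpos by (auto simp: mult_left_le_one_le)
    ultimately have "infdist (w t + u *\<^sub>R (z - w t)) K > \<delta> / 2" using tmin by simp
    moreover have "infdist (w t + u *\<^sub>R (z - w t)) K \<le> dist (w t + u *\<^sub>R (z - w t)) k"
      by (rule infdist_le[OF k(1)])
    ultimately show False using u(3) k tle by simp
  qed
  \<comment> \<open>The order on the line is \<open>y\<close>, \<open>z\<close>, \<open>w t\<close>,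
    \<open>x\<close>. Hence the value of \<open>e\<close> at \<open>y\<close> is at least that at
    \<open>w t\<close>, which exceeds that at \<open>k\<close>, contrary to
    \<open>ek\<close>.\<close>
  obtain r where r: "0 \<le> r" "r \<le> 1" "z = (1 - r) *\<^sub>R y + r *\<^sub>R x"
    using z(1) by (auto simp: in_segment)
  have "r \<noteq> 1" using r z \<open>x \<in> K\<close> by auto
  then have r1: "1 - r > 0" using r by simp
  have "z - x = (1 - r) *\<^sub>R (y - x)" using r by (simp add: algebra_simps)
  then have yx: "e \<bullet> (y - x) \<ge> 0" using dir r1 by (simp add: zero_le_mult_iff)
  have "w t - x = (1 - t) *\<^sub>R (z - x)" by (simp add: w_def algebra_simps)
  also have "\<dots> = ((1 - t) * (1 - r)) *\<^sub>R (y - x)" using \<open>z - x = _\<close> by simp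
  finally have wx: "w t = x + ((1 - t) * (1 - r)) *\<^sub>R (y - x)" by (simp add: algebra_simps)
  have le1: "(1 - t) * (1 - r) \<le> 1" using t01 r by (intro mult_le_one) auto
  have "y - w t = (1 - (1 - t) * (1 - r)) *\<^sub>R (y - x)" unfolding wx by (simp add: algebra_simps)
  then have "e \<bullet> (y - w t) \<ge> 0" using yx le1 by simp
  moreover have "e \<bullet> (w t - k) > 0" using e by (simp add: e_def)
  ultimately show False using ek by (simp add: inner_diff_right)
qed

text \<open>For each fixed parameter \<open>u\<close>, membership of the corresponding point of the
  segment in \<open>K\<close> is a closed condition on \<open>z\<close>.\<close>

lemma compact_sees:
  fixes K :: "'a::euclidean_space set"
  assumes "compact K"
  shows "compact {z. sees K z x}"
proof -
  have eq: "{z. sees K z x} = K \<inter> (\<Inter>u\<in>{0..1}. (\<lambda>z. (1 - u) *\<^sub>R z + u *\<^sub>R x) -` K)"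
    (is "_ = ?R")
  proof (intro equalityI subsetI)
    fix z assume "z \<in> {z. sees K z x}"
    then have seg: "closed_segment z x \<subseteq> K" by (simp add: sees_def)
    then have "(1 - u) *\<^sub>R z + u *\<^sub>R x \<in> K" if "u \<in> {0..1}" for u
      using that subsetD[OF seg, of "(1 - u) *\<^sub>R z + u *\<^sub>R x"] by (auto simp: in_segment)
    with seg show "z \<in> ?R" by auto
  qed (auto simp: sees_def in_segment)
  have "closed ((\<lambda>z. (1 - u) *\<^sub>R z + u *\<^sub>R x) -` K)" for u
    using assms compact_imp_closed by (intro continuous_closed_vimage) auto
  then show ?thesis
    unfolding eq using assms by (intro compact_Int_closed closed_INT) auto
qed

section \<open>Lower triangular matrices\<close>

definition lower_triangular :: "real ^ 'd::_ ^ 'd::{finite,linorder} \<Rightarrow> bool" where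
  "lower_triangular L \<longleftrightarrow> (\<forall>i j. i < j \<longrightarrow> L $ i $ j = 0)"

text \<open>The \<open>i\<close>-th column of an inverse is orthogonal to every row of
  \<open>X\<close> but the \<open>i\<close>-th.\<close>

lemma row_notin_span_of_other_rows:
  fixes X :: "real ^ 'd ^ 'd"
  assumes "invertible X" "i \<notin> S"
  shows "X $ i \<notin> span ((\<lambda>k. X $ k) ` S)"
proof
  assume span: "X $ i \<in> span ((\<lambda>k. X $ k) ` S)"
  obtain Y where "X ** Y = mat 1"
    using assms(1) by (auto simp: invertible_def)
  then have "X *v (Y *v axis i 1) = axis i 1"
    by (simp add: matrix_vector_mul_assoc)
  then have w: "X $ k \<bullet> (Y *v axis i 1) = axis i 1 $ k" for k
    by (metis matrix_vector_mul_component)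
  have "orthogonal (Y *v axis i 1) (X $ i)"
  proof (rule orthogonal_to_span[OF span])
    fix y assume "y \<in> (\<lambda>k. X $ k) ` S"
    then show "orthogonal (Y *v axis i 1) y"
      using w assms(2) by (auto simp: orthogonal_def inner_commute axis_def)
  qed
  then show False using w[of i] by (simp add: orthogonal_def inner_commute)
qed

text \<open>Gram-Schmidt on the rows gives an orthogonal \<open>Q\<close> with \<open>X ** Q\<close>
  lower triangular, and \<open>Q\<close> maps the unit ball onto itself.\<close>

lemma lower_triangular_image_cball:
  fixes X :: "real ^ 'd::_ ^ 'd::{finite,linorder}"
  assumes "invertible X"
  obtains L where "lower_triangular L" "\<And>i. 0 < L $ i $ i"
    "(\<lambda>v. L *v v) ` cball 0 1 = (\<lambda>v. X *v v) ` cball 0 1"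
proof -
  define R where "R j = (\<lambda>k. X $ k) ` {k. k < j}" for j
  have "\<exists>q. norm q = 1 \<and> (\<forall>k<j. q \<bullet> X $ k = 0) \<and> 0 < q \<bullet> X $ j \<and> q \<in> span (insert (X $ j) (R j))"
    for j
  proof -
    \<comment> \<open>\<open>z\<close> is the component of row \<open>j\<close> orthogonal to the
      earlier rows; normalised, it becomes \<open>q j\<close>.\<close>
    obtain y z where yz: "y \<in> span (R j)" "\<And>w. w \<in> span (R j) \<Longrightarrow> orthogonal z w" "X $ j = y + z"
      using orthogonal_subspace_decomp_exists[of "R j" "X $ j"] by blast
    have "z \<noteq> 0"
      using yz row_notin_span_of_other_rows[OF assms, of j "{k. k < j}"] by (auto simp: R_def)
    have zj: "z \<bullet> X $ j = z \<bullet> z"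
      using yz by (simp add: inner_add_right orthogonal_def)
    have "X $ j - y \<in> span (insert (X $ j) (R j))"
      by (rule span_diff[OF span_base[OF insertI1] subsetD[OF span_mono[OF subset_insertI] yz(1)]])
    then have "z \<in> span (insert (X $ j) (R j))" by (simp add: yz(3))
    moreover have "z \<bullet> X $ k = 0" if "k < j" for k
      using yz(2)[OF span_base, of "X $ k"] that by (auto simp: R_def orthogonal_def)
    ultimately show ?thesis
      using \<open>z \<noteq> 0\<close> zj by (intro exI[of _ "z /\<^sub>R norm z"]) (auto simp: span_scale)
  qed
  then obtain q where q: "\<And>j. norm (q j) = 1" "\<And>j k. k < j \<Longrightarrow> q j \<bullet> X $ k = 0"
      "\<And>j. 0 < q j \<bullet> X $ j" "\<And>j. q j \<in> span (insert (X $ j) (R j))"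
    by metis
  have orth_less: "orthogonal (q j) (q i)" if "i < j" for i j
  proof (rule orthogonal_to_span[OF q(4)])
    fix y assume "y \<in> insert (X $ i) (R i)"
    then show "orthogonal (q j) y"
      using that q(2) by (auto simp: R_def orthogonal_def)
  qed
  have orth: "orthogonal (q i) (q j)" if "i \<noteq> j" for i j
    using that orth_less[of i j] orth_less[of j i] by (cases "i < j") (auto simp: orthogonal_commute)
  define Q :: "real ^ 'd::_ ^ 'd::_" where "Q = (\<chi> k j. q j $ k)"
  have col: "column j Q = q j" for j by (simp add: Q_def column_def)
  have Q: "orthogonal_matrix Q"
    unfolding orthogonal_matrix_orthonormal_columns col using q(1) orth by blast
  then have "orthogonal_transformation ((*v) Q)"
    by (simp add: orthogonal_transformation_matrix)
  then have Qball: "(*v) Q ` cball 0 1 = cball 0 1"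
    by (simp add: image_orthogonal_transformation_cball)
  have XQ: "(X ** Q) $ i $ j = q j \<bullet> X $ i" for i j
    by (simp add: matrix_matrix_mult_def Q_def inner_vec_def mult.commute)
  show ?thesis
  proof
    show "lower_triangular (X ** Q)" by (simp add: lower_triangular_def XQ q(2))
    show "0 < (X ** Q) $ i $ i" for i by (simp add: XQ q(3))
    have "(*v) (X ** Q) ` cball 0 1 = (*v) X ` ((*v) Q ` cball 0 1)"
      by (simp add: image_image matrix_vector_mul_assoc)
    then show "(*v) (X ** Q) ` cball 0 1 = (*v) X ` cball 0 1" by (simp add: Qball)
  qed
qed

lemma measure_lower_triangular_ellipsoid:
  fixes L :: "real ^ 'd::_ ^ 'd::{finite,wellorder}"
  assumes "lower_triangular L" "\<And>i. 0 \<le> L $ i $ i"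
  shows "measure lebesgue ((\<lambda>v. a + L *v v) ` cball 0 1) =
    (\<Prod>i\<in>UNIV. L $ i $ i) * measure lebesgue (cball 0 1 :: (real ^ 'd::_) set)"
proof -
  have "measure lebesgue ((\<lambda>v. a + L *v v) ` cball 0 1) = measure lebesgue ((+) a ` (*v) L ` cball 0 1)"
    by (simp add: image_image)
  also have "\<dots> = \<bar>det L\<bar> * measure lebesgue (cball 0 1 :: (real ^ 'd::_) set)"
    by (simp add: measure_translation measure_linear_image)
  also have "det L = (\<Prod>i\<in>UNIV. L $ i $ i)"
    using assms(1) by (intro det_lowerdiagonal) (simp add: lower_triangular_def)
  finally show ?thesis using assms(2) by (simp add: prod_nonneg)
qed

lemma invertible_lower_triangular:
  fixes L :: "real ^ 'd::_ ^ 'd::{finite,wellorder}"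
  assumes "lower_triangular L" "(\<Prod>i\<in>UNIV. L $ i $ i) \<noteq> 0"
  shows "invertible L"
  using assms det_lowerdiagonal[of L] by (simp add: invertible_det_nz lower_triangular_def)

text \<open>Log-concavity of the product, from the weighted AM-GM inequality in each factor.\<close>

lemma prod_convex_combination_ge:
  fixes x y :: "'i \<Rightarrow> real"
  assumes "finite I" "\<And>i. i \<in> I \<Longrightarrow> 0 \<le> x i" "\<And>i. i \<in> I \<Longrightarrow> 0 \<le> y i"
    and c: "0 < c" "c \<le> prod x I" "c \<le> prod y I"
    and uv: "0 \<le> u" "0 \<le> v" "u + v = 1"
  shows "c \<le> (\<Prod>i\<in>I. u * x i + v * y i)"
proof -
  have pos: "0 < x i" "0 < y i" if "i \<in> I" for i
    using that assms by (metis less_eq_real_def not_less prod_zero_iff)+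
  have "c = c powr u * c powr v"
    using uv c by (simp flip: powr_add)
  also have "\<dots> \<le> prod x I powr u * prod y I powr v"
    using c uv by (intro mult_mono powr_mono2) auto
  also have "\<dots> = (\<Prod>i\<in>I. x i powr u * y i powr v)"
    using assms(2,3) by (simp add: prod.distrib prod_powr_distrib)
  also have "\<dots> \<le> (\<Prod>i\<in>I. u * x i + v * y i)"
    using pos uv by (intro prod_mono conjI Youngs_inequality_0) auto
  finally show ?thesis .
qed

section \<open>A Helly theorem for ellipsoids\<close>

text \<open>A lower bound on the determinant, unlike an equation, gives a convex set. Allowing zeros
  on the diagonal keeps the set closed; for positive \<open>c\<close> the product excludes
  them.\<close>

definition inscribed :: "real \<Rightarrow> (real ^ 'd::_) set \<Rightarrow> ((real ^ 'd::_) \<times> (real ^ 'd::_ ^ 'd::{finite,linorder})) set" where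
  "inscribed c C = {(a, L). lower_triangular L \<and> (\<forall>i. 0 \<le> L $ i $ i) \<and>
     c \<le> (\<Prod>i\<in>UNIV. L $ i $ i) \<and> (\<forall>v\<in>cball 0 1. a + L *v v \<in> C)}"

text \<open>Both ellipsoids are parametrised by the same unit ball, so their pointwise combination
  stays in \<open>C\<close>.\<close>

lemma convex_inscribed:
  assumes "convex C" "0 < c"
  shows "convex (inscribed c C)"
proof (rule convexI)
  fix p q :: "(real ^ 'a::_) \<times> (real ^ 'a::_ ^ 'a::_)" and u v :: real
  assume pq: "p \<in> inscribed c C" "q \<in> inscribed c C" and uv: "0 \<le> u" "0 \<le> v" "u + v = 1"
  obtain a L b M where [simp]: "p = (a, L)" "q = (b, M)" by (cases p, cases q)
  have L: "lower_triangular L" "\<And>i. 0 \<le> L $ i $ i" "c \<le> (\<Prod>i\<in>UNIV. L $ i $ i)"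
      "\<And>w. w \<in> cball 0 1 \<Longrightarrow> a + L *v w \<in> C"
    and M: "lower_triangular M" "\<And>i. 0 \<le> M $ i $ i" "c \<le> (\<Prod>i\<in>UNIV. M $ i $ i)"
      "\<And>w. w \<in> cball 0 1 \<Longrightarrow> b + M *v w \<in> C"
    using pq by (auto simp: inscribed_def)
  have "u *\<^sub>R a + v *\<^sub>R b + (u *\<^sub>R L + v *\<^sub>R M) *v w \<in> C" if "w \<in> cball 0 1" for w
  proof -
    have "u *\<^sub>R (a + L *v w) + v *\<^sub>R (b + M *v w) \<in> C"
      using assms(1) L(4)[OF that] M(4)[OF that] uv by (rule convexD)
    also have "u *\<^sub>R (a + L *v w) + v *\<^sub>R (b + M *v w) =
        u *\<^sub>R a + v *\<^sub>R b + (u *\<^sub>R L + v *\<^sub>R M) *v w"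
      by (simp add: matrix_vector_mult_add_rdistrib scaleR_matrix_vector_assoc algebra_simps)
    finally show ?thesis .
  qed
  moreover have "c \<le> (\<Prod>i\<in>UNIV. u * L $ i $ i + v * M $ i $ i)"
    using assms(2) L M uv by (intro prod_convex_combination_ge) auto
  ultimately show "u *\<^sub>R p + v *\<^sub>R q \<in> inscribed c C"
    using L(1,2) M(1,2) uv by (simp add: inscribed_def lower_triangular_def)
qed

text \<open>The defining conditions are closed. For boundedness, the centre lies in \<open>C\<close>
  and each column of \<open>L\<close> is a difference of two points of \<open>C\<close>.\<close>

lemma compact_inscribed:
  assumes "compact C"
  shows "compact (inscribed c C)"
proof -
  have lin: "linear (\<lambda>p :: (real ^ 'a::_) \<times> (real ^ 'a::_ ^ 'a::_). fst p + snd p *v w)" for w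
    by (rule linearI)
       (simp_all add: matrix_vector_mult_add_rdistrib scaleR_matrix_vector_assoc algebra_simps)
  have cont: "isCont (\<lambda>p :: (real ^ 'a::_) \<times> (real ^ 'a::_ ^ 'a::_). fst p + snd p *v w) x" for w x
    using lin[of w] by (intro linear_continuous_at) (simp add: linear_conv_bounded_linear)
  have entry: "continuous_on UNIV (\<lambda>p :: (real ^ 'a::_) \<times> (real ^ 'a::_ ^ 'a::_). snd p $ i $ j)" for i j
    by (intro continuous_intros)
  have "inscribed c C = {p. \<forall>i j. i < j \<longrightarrow> snd p $ i $ j = 0} \<inter> {p. \<forall>i. 0 \<le> snd p $ i $ i} \<inter>
      {p. c \<le> (\<Prod>i\<in>UNIV. snd p $ i $ i)} \<inter>
      (\<Inter>w\<in>cball 0 1. (\<lambda>p. fst p + snd p *v w) -` C)"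
    by (auto simp: inscribed_def lower_triangular_def)
  moreover have "closed \<dots>"
    using assms compact_imp_closed
    by (intro closed_Int closed_INT ballI closed_Collect_all closed_Collect_imp closed_Collect_eq
        closed_Collect_le entry continuous_on_prod continuous_on_const open_Collect_const
        continuous_closed_vimage cont) auto
  ultimately have "closed (inscribed c C)" by simp
  moreover have "bounded (inscribed c C)"
  proof -
    obtain r where r: "\<And>x. x \<in> C \<Longrightarrow> norm x \<le> r"
      using assms compact_imp_bounded bounded_iff by metis
    define d where "d = real CARD('a)"
    have "norm p \<le> r + d * (d * (2 * r))" if "p \<in> inscribed c C" for p
    proof -
      obtain a L where p: "p = (a, L)" by (cases p)
      have in_C: "a + L *v v \<in> C" if "norm v \<le> 1" for v
        using that \<open>p \<in> _\<close> by (auto simp: inscribed_def p)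
      have a: "norm a \<le> r" using r[OF in_C[of 0]] by simp
      have entry: "\<bar>L $ i $ j\<bar> \<le> 2 * r" for i j
      proof -
        have "norm (a + L *v axis j 1) \<le> r" by (rule r[OF in_C]) simp
        then have "norm (L *v axis j 1) \<le> 2 * r"
          using a norm_triangle_ineq4[of "a + L *v axis j 1" a] by simp
        moreover have "(L *v axis j 1) $ i = L $ i $ j"
          by (simp add: matrix_vector_mul_component inner_axis)
        ultimately show ?thesis by (metis component_le_norm_cart order_trans)
      qed
      have "norm (L $ i) \<le> d * (2 * r)" for i
        using norm_le_l1_cart[of "L $ i"] sum_bounded_above[of UNIV "\<lambda>j. \<bar>L $ i $ j\<bar>" "2 * r"] entry
        by (simp add: d_def)
      then have "norm L \<le> d * (d * (2 * r))"
        using L2_set_le_sum[of UNIV "\<lambda>i. norm (L $ i)"]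
          sum_bounded_above[of UNIV "\<lambda>i. norm (L $ i)" "d * (2 * r)"]
        by (simp add: norm_vec_def d_def)
      then show ?thesis using a norm_Pair_le[of a L] by (simp add: p)
    qed
    then show ?thesis unfolding bounded_iff by blast
  qed
  ultimately show ?thesis by (simp add: compact_eq_bounded_closed)
qed

section \<open>Shrinking and projecting out the last diagonal entry\<close>

definition set_corner :: "'d \<Rightarrow> real \<Rightarrow> real ^ 'd ^ 'd \<Rightarrow> real ^ 'd ^ 'd" where
  "set_corner m t L = (\<chi> i j. if i = m \<and> j = m then t else L $ i $ j)"

lemma set_corner_nth [simp]:
  "set_corner m t L $ i $ j = (if i = m \<and> j = m then t else L $ i $ j)"
  by (simp add: set_corner_def)

lemma set_corner_set_corner [simp]: "set_corner m s (set_corner m t L) = set_corner m s L"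
  by (simp add: vec_eq_iff)

text \<open>As \<open>m\<close> is the largest index, the corner is the only entry of column
  \<open>m\<close> that can be nonzero. Lowering it amounts to contracting coordinate
  \<open>m\<close> before applying \<open>L\<close>, and this maps the unit ball into
  itself.\<close>

lemma inscribed_set_corner:
  fixes a :: "real ^ 'd::{finite,linorder}"
  assumes "(a, L) \<in> inscribed c C" and m: "\<And>i. i \<le> m"
    and t: "0 \<le> t" "t \<le> L $ m $ m" "c \<le> t * (\<Prod>i\<in>UNIV - {m}. L $ i $ i)"
  shows "(a, set_corner m t L) \<in> inscribed c C"
proof -
  have L: "lower_triangular L" "\<And>i. 0 \<le> L $ i $ i" "\<And>w. norm w \<le> 1 \<Longrightarrow> a + L *v w \<in> C"
    using assms(1) by (auto simp: inscribed_def)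
  have "a + set_corner m t L *v v \<in> C" if v: "norm v \<le> 1" for v
  proof -
    \<comment> \<open>If the corner entry is 0, then so is \<open>t\<close>, and division by zero
      yields the suitable value 0.\<close>
    define s where "s = t / L $ m $ m"
    have s: "0 \<le> s" "s \<le> 1" "s * L $ m $ m = t"
      using t L(2)[of m] by (auto simp: s_def divide_le_eq_1)
    define w where "w = (\<chi> j. if j = m then s * v $ j else v $ j)"
    have "norm w \<le> norm v"
      using s by (intro norm_le_componentwise_cart) (auto simp: w_def abs_mult mult_left_le_one_le)
    then have "a + L *v w \<in> C" using v by (intro L(3)) simp
    moreover have "set_corner m t L $ i $ j * v $ j = L $ i $ j * w $ j" for i j
    proof (cases "i = m")
      case False
      then have "i < m" using m[of i] by simp
      then have "L $ i $ m = 0" using L(1) by (simp add: lower_triangular_def)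
      then show ?thesis using False by (simp add: w_def)
    qed (use s in \<open>auto simp: w_def\<close>)
    then have "set_corner m t L *v v = L *v w"
      by (simp add: matrix_vector_mult_def)
    ultimately show ?thesis by simp
  qed
  moreover have "c \<le> (\<Prod>i\<in>UNIV. set_corner m t L $ i $ i)"
    using t(3) by (subst prod.remove[of UNIV m]) auto
  ultimately show ?thesis
    using L t m by (auto simp: inscribed_def lower_triangular_def leD)
qed

definition drop_corner :: "'d \<Rightarrow> (real ^ 'd) \<times> (real ^ 'd ^ 'd) \<Rightarrow> (real ^ 'd) \<times> (real ^ 'd ^ 'd)" where
  "drop_corner m p = (fst p, set_corner m 0 (snd p))"

lemma linear_drop_corner: "linear (drop_corner m)"
  by (rule linearI) (auto simp: drop_corner_def vec_eq_iff)

text \<open>Over a given point of the projection, the volume bound determines the smallest admissible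
  corner entry, and this entry does not depend on the convex body. Hence the projections
  have a common point only if the original sets have one, and Helly's theorem may be applied
  in one dimension less.\<close>

lemma inscribed_common_point:
  fixes C :: "'i \<Rightarrow> (real ^ 'd::{finite,linorder}) set"
  assumes m: "\<And>i. i \<le> m" and "0 < c" "I \<noteq> {}"
    and b: "b \<in> (\<Inter>x\<in>I. drop_corner m ` inscribed c (C x))"
  shows "(\<Inter>x\<in>I. inscribed c (C x)) \<noteq> {}"
proof -
  obtain a L where [simp]: "b = (a, L)" by (cases b)
  define P where "P = (\<Prod>i\<in>UNIV - {m}. L $ i $ i)"
  \<comment> \<open>\<open>P\<close> is read off \<open>b\<close>: every lift \<open>M\<close> has
    the same diagonal entries outside the corner.\<close>
  have "(a, set_corner m (c / P) L) \<in> inscribed c (C x)" if x: "x \<in> I" for x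
  proof -
    obtain M where M: "(a, M) \<in> inscribed c (C x)" "L = set_corner m 0 M"
      using b x by (force simp: drop_corner_def)
    have P: "P = (\<Prod>i\<in>UNIV - {m}. M $ i $ i)"
      by (auto simp: P_def M(2) intro!: prod.cong)
    have diag: "0 \<le> M $ i $ i" for i using M(1) by (auto simp: inscribed_def)
    have cP: "c \<le> M $ m $ m * P"
      using M(1) prod.remove[of UNIV m "\<lambda>i. M $ i $ i"] by (simp add: inscribed_def P)
    moreover have "0 \<le> P" unfolding P by (intro prod_nonneg) (use diag in auto)
    ultimately have "0 < P" using \<open>0 < c\<close> by (cases "P = 0") auto
    have "(a, set_corner m (c / P) M) \<in> inscribed c (C x)"
      using \<open>0 < P\<close> \<open>0 < c\<close> cP M(1) m
      by (intro inscribed_set_corner) (auto simp: divide_le_eq simp flip: P)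
    then show ?thesis by (simp add: M(2))
  qed
  then show ?thesis by blast
qed

text \<open>These pairs and their swaps cover the square and overlap in the diagonal.\<close>

lemma card_le_pairs:
  "2 * card {(i, j :: 'd::{finite,linorder}). j \<le> i} = CARD('d) * (CARD('d) + 1)"
proof -
  let ?A = "{(i, j :: 'd). j \<le> i}" and ?B = "{(i, j :: 'd). i \<le> j}"
  have "card ?B = card (prod.swap ` ?A)"
    by (rule arg_cong[where f = card]) (auto simp: image_iff)
  also have "\<dots> = card ?A" by (rule card_image) auto
  finally have "card ?A + card ?A = card (?A \<union> ?B) + card (?A \<inter> ?B)"
    using card_Un_Int[of ?A ?B] by simp
  also have "?A \<union> ?B = UNIV" by auto
  also have "?A \<inter> ?B = (\<lambda>i. (i, i)) ` UNIV" by auto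
  also have "card \<dots> = CARD('d)" by (rule card_image) (auto simp: inj_on_def)
  finally show ?thesis by simp
qed

text \<open>With \<open>d = CARD('d)\<close>, the centre contributes \<open>d\<close>, the lower
  triangle \<open>d (d + 1) / 2\<close>, and the vanishing corner removes one.\<close>

lemma dim_lower_triangular_less:
  fixes m :: "'d::{finite,linorder}"
  shows "dim {p :: (real ^ 'd::_) \<times> (real ^ 'd::_ ^ 'd::_). lower_triangular (snd p) \<and> snd p $ m $ m = 0}
     < CARD('d) * (CARD('d) + 3) div 2" (is "dim ?V < _")
proof -
  define T where "T = {(i, j :: 'd). j \<le> i} - {(m, m)}"
  let ?v = "\<lambda>i. (axis i 1, 0) :: (real ^ 'd::_) \<times> (real ^ 'd::_ ^ 'd::_)"
  let ?w = "\<lambda>(i, j). (0, axis i (axis j 1)) :: (real ^ 'd::_) \<times> (real ^ 'd::_ ^ 'd::_)"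
  define B where "B = ?v ` UNIV \<union> ?w ` T"
  have "?V \<subseteq> span B"
  proof
    fix p assume "p \<in> ?V"
    then obtain a L where p: "p = (a, L)" and L: "\<And>i j. (i, j) \<notin> T \<Longrightarrow> L $ i $ j = 0"
      by (cases p) (auto simp: T_def lower_triangular_def not_le)
    have "p = (\<Sum>i\<in>UNIV. a $ i *\<^sub>R ?v i) + (\<Sum>ij\<in>T. (L $ fst ij $ snd ij) *\<^sub>R ?w ij)"
    proof -
      have "(\<Sum>i\<in>UNIV. a $ i *\<^sub>R ?v i) = (a, 0)"
        by (auto simp: sum_prod vec_eq_iff axis_def if_distrib cong: if_cong)
      moreover have "(\<Sum>ij\<in>T. (L $ fst ij $ snd ij) *\<^sub>R ?w ij) =
          (\<Sum>ij\<in>UNIV. (L $ fst ij $ snd ij) *\<^sub>R ?w ij)"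
        using L by (intro sum.mono_neutral_left) auto
      moreover have "\<dots> = (\<Sum>i\<in>UNIV. \<Sum>j\<in>UNIV. (L $ i $ j) *\<^sub>R ?w (i, j))"
        by (simp add: sum.cartesian_product case_prod_unfold UNIV_Times_UNIV)
      moreover have "\<dots> = (0, \<Sum>i\<in>UNIV. \<Sum>j\<in>UNIV. (L $ i $ j) *\<^sub>R axis i (axis j 1))"
        by (simp add: sum_prod)
      moreover have "(\<Sum>i\<in>UNIV. \<Sum>j\<in>UNIV. (L $ i $ j) *\<^sub>R axis i (axis j 1)) = L"
      proof -
        have "(\<Sum>i\<in>UNIV. \<Sum>j\<in>UNIV. L $ i $ j * axis i (axis j 1) $ k $ l) = L $ k $ l" for k l
        proof -
          have "L $ i $ j * axis i (axis j 1) $ k $ l =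
              (if j = l then if i = k then L $ i $ j else 0 else 0)" for i j
            by (auto simp: axis_def)
          then show ?thesis by simp
        qed
        then show ?thesis by (simp add: vec_eq_iff)
      qed
      ultimately show ?thesis by (simp add: p)
    qed
    also have "\<dots> \<in> span B"
      by (intro span_add span_sum span_scale span_base) (auto simp: B_def)
    finally show "p \<in> span B" .
  qed
  then have "dim ?V \<le> card B"
    by (rule dim_le_card) (simp add: B_def T_def)
  also have "\<dots> \<le> CARD('d) + card T"
    unfolding B_def by (rule order.trans[OF card_Un_le]) (intro add_mono card_image_le; simp add: T_def)
  also have "card T = card {(i, j :: 'd). j \<le> i} - 1"
    unfolding T_def by (subst card_Diff_singleton) auto
  finally have "dim ?V \<le> CARD('d) + (card {(i, j :: 'd). j \<le> i} - 1)" .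
  moreover have eq: "CARD('d) * (CARD('d) + 3) = 2 * (CARD('d) + card {(i, j :: 'd). j \<le> i})"
    using card_le_pairs[where 'd = 'd] by (simp add: algebra_simps)
  \<comment> \<open>This makes the truncated subtraction of 1 genuine and the inequality
    strict.\<close>
  moreover have "card {(i, j :: 'd). j \<le> i} \<noteq> 0"
    using card_le_pairs[where 'd = 'd] by (intro notI) simp
  moreover have "CARD('d) * (CARD('d) + 3) div 2 = CARD('d) + card {(i, j :: 'd). j \<le> i}"
    unfolding eq by (rule nonzero_mult_div_cancel_left) simp
  ultimately show ?thesis by linarith
qed

text \<open>\<open>p\<close> is chosen before \<open>C\<close>, so one pair serves all bodies
  containing \<open>E\<close>. The bound is the determinant that volume 1 requires.\<close>

lemma ellipsoid_inscribed:
  fixes E :: "(real ^ 'd::{finite,wellorder}) set"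
  assumes "ellipsoid E" "measure lebesgue E = 1"
  obtains p where "\<And>C. E \<subseteq> C \<Longrightarrow> p \<in> inscribed (1 / measure lebesgue (cball 0 1 :: (real ^ 'd::_) set)) C"
proof -
  obtain a and X :: "real ^ 'd::_ ^ 'd::_" where X: "invertible X" "E = (\<lambda>v. a + X *v v) ` cball 0 1"
    using assms(1) by (auto simp: ellipsoid_def)
  obtain L where L: "lower_triangular L" "\<And>i. 0 < L $ i $ i"
      "(\<lambda>v. L *v v) ` cball 0 1 = (\<lambda>v. X *v v) ` cball 0 1"
    using lower_triangular_image_cball[OF X(1)] by blast
  have "(\<lambda>v. a + L *v v) ` cball 0 1 = (+) a ` (\<lambda>v. L *v v) ` cball 0 1"
    by (simp add: image_image)
  then have E: "E = (\<lambda>v. a + L *v v) ` cball 0 1"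
    by (simp add: L(3) X(2) image_image)
  have "(\<Prod>i\<in>UNIV. L $ i $ i) * measure lebesgue (cball 0 1 :: (real ^ 'd::_) set) = 1"
    using measure_lower_triangular_ellipsoid[OF L(1), of a] L(2) assms(2) E by (simp add: less_imp_le)
  then have "1 / measure lebesgue (cball 0 1 :: (real ^ 'd::_) set) = (\<Prod>i\<in>UNIV. L $ i $ i)"
    by (auto simp: divide_eq_eq)
  then have "(a, L) \<in> inscribed (1 / measure lebesgue (cball 0 1 :: (real ^ 'd::_) set)) C" if "E \<subseteq> C" for C
    using L(1,2) that E by (auto simp: inscribed_def less_imp_le)
  then show ?thesis by (rule that)
qed

text \<open>Contracting about the centre lowers the volume to exactly 1 without leaving any
  \<open>C x\<close>. The condition over \<open>UNIV\<close> supplies the determinant bound when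
  \<open>I\<close> is empty.\<close>

lemma inscribed_contains_ellipsoid:
  fixes p :: "(real ^ 'd::_) \<times> (real ^ 'd::_ ^ 'd::{finite,wellorder})"
  assumes c: "c = 1 / measure lebesgue (cball 0 1 :: (real ^ 'd::_) set)"
    and p: "\<And>x. x \<in> I \<Longrightarrow> p \<in> inscribed c (C x)" "p \<in> inscribed c UNIV"
  obtains E where "ellipsoid E" "measure lebesgue E = 1" "\<And>x. x \<in> I \<Longrightarrow> E \<subseteq> C x"
proof -
  have pos: "0 < measure lebesgue (cball 0 1 :: (real ^ 'd::_) set)" by simp
  obtain a L where [simp]: "p = (a, L)" by (cases p)
  have L: "lower_triangular L" "\<And>i. 0 \<le> L $ i $ i" "c \<le> (\<Prod>i\<in>UNIV. L $ i $ i)"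
    using p(2) by (auto simp: inscribed_def)
  define P where "P = (\<Prod>i\<in>UNIV. L $ i $ i)"
  have "0 < c" using pos by (simp add: c)
  then have "0 < P" using L(3) by (simp add: P_def)
  \<comment> \<open>Scaling by \<open>s\<close> multiplies the determinant \<open>P\<close> by
    \<open>s ^ CARD('d)\<close>, and the result has to be \<open>c\<close>.\<close>
  define s where "s = root CARD('d) (c / P)"
  have s: "0 < s" "s \<le> 1" "s ^ CARD('d) = c / P"
    using \<open>0 < c\<close> \<open>0 < P\<close> L(3) by (auto simp: s_def P_def[symmetric])
  define M where "M = s *\<^sub>R L"
  have M: "lower_triangular M" "\<And>i. 0 \<le> M $ i $ i"
    using L s by (auto simp: M_def lower_triangular_def)
  have "(\<Prod>i\<in>UNIV. M $ i $ i) = s ^ CARD('d) * P"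
    by (simp add: M_def P_def prod.distrib)
  then have prod_M: "(\<Prod>i\<in>UNIV. M $ i $ i) = c" using s \<open>0 < P\<close> by simp
  show ?thesis
  proof
    show "ellipsoid ((\<lambda>v. a + M *v v) ` cball 0 1)"
      using invertible_lower_triangular[OF M(1)] prod_M \<open>0 < c\<close> by (auto simp: ellipsoid_def)
    show "measure lebesgue ((\<lambda>v. a + M *v v) ` cball 0 1) = 1"
      using measure_lower_triangular_ellipsoid[OF M] prod_M pos by (simp add: c)
    show "(\<lambda>v. a + M *v v) ` cball 0 1 \<subseteq> C x" if "x \<in> I" for x
    proof clarify
      fix v :: "real ^ 'd::_" assume "v \<in> cball 0 1"
      then have "s *\<^sub>R v \<in> cball 0 1" using s by (simp add: mult_le_one)
      then have "a + L *v (s *\<^sub>R v) \<in> C x"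
        using p(1)[OF that] by (auto simp: inscribed_def)
      then show "a + M *v v \<in> C x"
        by (simp add: M_def scaleR_matrix_vector_assoc matrix_vector_mult_scaleR)
    qed
  qed
qed

text \<open>Settles empty families. A ball of radius \<open>c + 1\<close> is large enough to be
  contracted to volume 1.\<close>

lemma exists_unit_volume_ellipsoid:
  "\<exists>E :: (real ^ 'd::{finite,wellorder}) set. ellipsoid E \<and> measure lebesgue E = 1"
proof -
  define c where "c = 1 / measure lebesgue (cball 0 1 :: (real ^ 'd::_) set)"
  have "0 < c" by (simp add: c_def)
  have "c \<le> (c + 1) ^ CARD('d)"
    using \<open>0 < c\<close> self_le_power[of "c + 1" "CARD('d)"] by simp
  then have p: "((0 :: real ^ 'd::_), mat (c + 1)) \<in> inscribed c UNIV"
    using \<open>0 < c\<close> by (auto simp: inscribed_def lower_triangular_def mat_def)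
  show ?thesis
    using inscribed_contains_ellipsoid[OF c_def _ p, of "{}" "\<lambda>_. UNIV"] by auto
qed

theorem Helly_ellipsoid:
  fixes C :: "'i \<Rightarrow> (real ^ 'd::{finite,wellorder}) set"
  assumes "\<And>x. x \<in> I \<Longrightarrow> convex (C x)" "\<And>x. x \<in> I \<Longrightarrow> compact (C x)"
    and sub: "\<And>J. finite J \<Longrightarrow> J \<subseteq> I \<Longrightarrow> card J \<le> CARD('d) * (CARD('d) + 3) div 2 \<Longrightarrow>
      \<exists>E. ellipsoid E \<and> measure lebesgue E = 1 \<and> (\<forall>x\<in>J. E \<subseteq> C x)"
  shows "\<exists>E. ellipsoid E \<and> measure lebesgue E = 1 \<and> (\<forall>x\<in>I. E \<subseteq> C x)"
proof (cases "I = {}")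
  case True
  then show ?thesis using exists_unit_volume_ellipsoid by blast
next
  case False
  define c where "c = 1 / measure lebesgue (cball 0 1 :: (real ^ 'd::_) set)"
  have "0 < c" by (simp add: c_def)
  define m :: 'd where "m = Max UNIV"
  have m: "i \<le> m" for i by (simp add: m_def)
  define D where "D x = drop_corner m ` inscribed c (C x)" for x
  define V where "V = {p :: (real ^ 'd::_) \<times> (real ^ 'd::_ ^ 'd::_). lower_triangular (snd p) \<and> snd p $ m $ m = 0}"
  \<comment> \<open>By \<open>dimV\<close> the subtraction is not truncated, so \<open>k + 1\<close>
    is the number of sets allowed in \<open>sub\<close>.\<close>
  define k where "k = CARD('d) * (CARD('d) + 3) div 2 - 1"
  have dimV: "dim V < CARD('d) * (CARD('d) + 3) div 2"
    unfolding V_def by (rule dim_lower_triangular_less)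
  have "(\<Inter>x\<in>I. D x) \<noteq> {}"
  proof (rule Helly_dim_compact)
    show "dim V \<le> k" using dimV by (simp add: k_def)
    show "convex (D x)" if "x \<in> I" for x
      unfolding D_def using that assms(1) \<open>0 < c\<close>
      by (intro convex_linear_image linear_drop_corner convex_inscribed)
    show "compact (D x)" if "x \<in> I" for x
      unfolding D_def using that assms(2) linear_drop_corner[of m]
      by (intro compact_continuous_image compact_inscribed linear_continuous_on)
         (simp_all add: linear_conv_bounded_linear)
    show "D x \<subseteq> V" if "x \<in> I" for x
      by (auto simp: D_def V_def drop_corner_def inscribed_def lower_triangular_def)
    show "(\<Inter>x\<in>J. D x) \<noteq> {}" if J: "finite J" "J \<subseteq> I" "card J \<le> k + 1" for J
    proof -
      obtain E where E: "ellipsoid E" "measure lebesgue E = 1" "\<And>x. x \<in> J \<Longrightarrow> E \<subseteq> C x"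
        using sub[OF J(1,2)] J(3) dimV by (auto simp: k_def)
      obtain p where "\<And>C. E \<subseteq> C \<Longrightarrow> p \<in> inscribed c C"
        unfolding c_def using ellipsoid_inscribed[OF E(1,2)] by blast
      with E(3) have "drop_corner m p \<in> (\<Inter>x\<in>J. D x)" by (auto simp: D_def)
      then show ?thesis by blast
    qed
  qed
  then obtain b where "b \<in> (\<Inter>x\<in>I. drop_corner m ` inscribed c (C x))"
    unfolding D_def by blast
  then have "(\<Inter>x\<in>I. inscribed c (C x)) \<noteq> {}"
    by (rule inscribed_common_point[OF m \<open>0 < c\<close> False])
  then obtain p where p: "\<And>x. x \<in> I \<Longrightarrow> p \<in> inscribed c (C x)" by blast
  moreover obtain x where "x \<in> I" using False by blast
  with p[of x] have "p \<in> inscribed c UNIV" by (auto simp: inscribed_def)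
  ultimately obtain E where "ellipsoid E" "measure lebesgue E = 1" "\<And>x. x \<in> I \<Longrightarrow> E \<subseteq> C x"
    using inscribed_contains_ellipsoid[OF c_def, of I p C] by blast
  then show ?thesis by blast
qed

section \<open>Ellipsoids in the kernel\<close>

lemma kernel_ellipsoid_wellorder:
  fixes K :: "(real ^ 'd::{finite,wellorder}) set"
  assumes "compact K"
    and hyp: "\<And>p :: nat \<Rightarrow> real ^ 'd::_.
           (\<forall>i < CARD('d) * (CARD('d) + 3) div 2. p i \<in> K) \<Longrightarrow>
           \<exists>E. ellipsoid E \<and> measure lebesgue E = 1 \<and>
               (\<forall>x\<in>E. \<forall>i < CARD('d) * (CARD('d) + 3) div 2. sees K x (p i))"
  shows "\<exists>E. ellipsoid E \<and> measure lebesgue E = 1 \<and> (\<forall>x\<in>E. \<forall>y\<in>K. sees K x y)"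
proof -
  have "\<exists>E. ellipsoid E \<and> measure lebesgue E = 1 \<and> (\<forall>y\<in>K. E \<subseteq> convex hull {z. sees K z y})"
  proof (rule Helly_ellipsoid)
    show "compact (convex hull {z. sees K z y})" for y
      using compact_sees[OF assms(1)] by (rule compact_convex_hull)
    fix J assume J: "finite J" "J \<subseteq> K" "card J \<le> CARD('d) * (CARD('d) + 3) div 2"
    show "\<exists>E. ellipsoid E \<and> measure lebesgue E = 1 \<and> (\<forall>y\<in>J. E \<subseteq> convex hull {z. sees K z y})"
    proof (cases "J = {}")
      case True
      then show ?thesis using exists_unit_volume_ellipsoid by blast
    next
      case False
      then obtain y0 where "y0 \<in> J" by blast
      obtain h where h: "bij_betw h {0..<card J} J"
        using ex_bij_betw_nat_finite[OF J(1)] by blast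
      \<comment> \<open>The hypothesis speaks of sequences of full length, so the enumeration of
        \<open>J\<close> is padded with \<open>y0\<close>.\<close>
      define p where "p i = (if i < card J then h i else y0)" for i
      have "p i \<in> K" for i
        using h J(2) \<open>y0 \<in> J\<close> by (auto simp: p_def bij_betw_def)
      then obtain E where E: "ellipsoid E" "measure lebesgue E = 1"
          "\<And>x i. x \<in> E \<Longrightarrow> i < CARD('d) * (CARD('d) + 3) div 2 \<Longrightarrow> sees K x (p i)"
        using hyp[of p] by blast
      have "E \<subseteq> convex hull {z. sees K z y}" if "y \<in> J" for y
      proof -
        have "y \<in> h ` {0..<card J}" using h that by (simp add: bij_betw_def)
        then obtain i where "i < card J" "y = h i" by auto
        then have "E \<subseteq> {z. sees K z y}" using E(3)[of _ i] J(3) by (auto simp: p_def)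
        then show ?thesis using hull_subset by (rule order_trans)
      qed
      then show ?thesis using E(1,2) by blast
    qed
  qed simp
  then obtain E where E: "ellipsoid E" "measure lebesgue E = 1"
      "\<And>y. y \<in> K \<Longrightarrow> E \<subseteq> convex hull {z. sees K z y}" by blast
  have "sees K x y" if "x \<in> E" "y \<in> K" for x y
    using compact_imp_closed[OF assms(1)] _ that(2)
  proof (rule krasnoselskii_kernel)
    show "x \<in> convex hull {z. sees K z y}" if "y \<in> K" for y
      using E(3)[OF that] \<open>x \<in> E\<close> by (rule subsetD)
  qed
  with E show ?thesis by blast
qed

section \<open>Arbitrary finite index types\<close>

text \<open>The library computes the volume of a linear image only over a well-ordered index type.
  A copy of the index type, ordered by an enumeration, provides one.\<close>

typedef 'a enumerated = "UNIV :: 'a set" ..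

definition enumerated_rank :: "'a::finite enumerated \<Rightarrow> nat" where
  "enumerated_rank = (SOME f. inj f)"

instance enumerated :: (finite) finite
proof
  have "(UNIV :: 'a enumerated set) = range Abs_enumerated"
    by (metis Rep_enumerated_inverse UNIV_eq_I rangeI)
  moreover have "finite (range (Abs_enumerated :: 'a \<Rightarrow> 'a enumerated))" by (rule finite_imageI) simp
  ultimately show "finite (UNIV :: 'a enumerated set)" by metis
qed

lemma inj_enumerated_rank: "inj (enumerated_rank :: 'a::finite enumerated \<Rightarrow> nat)"
proof -
  have "\<exists>f :: 'a enumerated \<Rightarrow> nat. inj f"
    using finite_imp_inj_to_nat_seg[of "UNIV :: 'a enumerated set"] by blast
  then show ?thesis unfolding enumerated_rank_def by (rule someI_ex)
qed

instantiation enumerated :: (finite) wellorder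
begin

definition "x \<le> y \<longleftrightarrow> enumerated_rank x \<le> enumerated_rank y"
definition "x < y \<longleftrightarrow> enumerated_rank x < enumerated_rank y"

instance
proof
  fix P :: "'a enumerated \<Rightarrow> bool" and x
  assume step: "\<And>x. (\<And>y. y < x \<Longrightarrow> P y) \<Longrightarrow> P x"
  show "P x"
  proof (induction "enumerated_rank x" arbitrary: x rule: less_induct)
    case less
    show ?case by (rule step) (simp add: less less_enumerated_def)
  qed
qed (auto simp: less_eq_enumerated_def less_enumerated_def dest: injD[OF inj_enumerated_rank])

end

section \<open>Relabelling coordinates\<close>

definition reindex :: "('b \<Rightarrow> 'a) \<Rightarrow> 'c ^ 'a \<Rightarrow> 'c ^ 'b" where
  "reindex h x = (\<chi> j. x $ h j)"

lemma reindex_nth [simp]: "reindex h x $ j = x $ h j"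
  by (simp add: reindex_def)

lemma linear_reindex: "linear (reindex h :: real ^ 'a \<Rightarrow> real ^ 'b)"
  by (rule linearI) (simp_all add: vec_eq_iff)

lemma reindex_inverse:
  assumes "bij h"
  shows "reindex (inv h) (reindex h x) = x" "reindex h (reindex (inv h) y) = y"
  using assms by (simp_all add: vec_eq_iff bij_is_inj bij_is_surj surj_f_inv_f)

lemma norm_reindex:
  fixes x :: "real ^ 'a" and h :: "'b::finite \<Rightarrow> 'a"
  assumes "bij h"
  shows "norm (reindex h x) = norm x"
  using sum.reindex_bij_betw[OF assms, of "\<lambda>i. (x $ i)\<^sup>2"] by (simp add: norm_vec_def L2_set_def)

lemma reindex_image_eq_vimage:
  assumes "bij h"
  shows "reindex h ` S = reindex (inv h) -` S"
proof (intro equalityI subsetI)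
  fix y assume "y \<in> reindex (inv h) -` S"
  then show "y \<in> reindex h ` S"
    by (intro image_eqI[of y "reindex h" "reindex (inv h) y"]) (simp_all add: reindex_inverse[OF assms])
next
  fix y assume "y \<in> reindex h ` S"
  then obtain x where "x \<in> S" "y = reindex h x" by (rule imageE)
  then show "y \<in> reindex (inv h) -` S" by (simp add: reindex_inverse[OF assms])
qed

lemma continuous_on_reindex: "continuous_on S (reindex h :: real ^ 'a \<Rightarrow> real ^ 'b)"
  using linear_reindex by (intro linear_continuous_on) (simp add: linear_conv_bounded_linear)

text \<open>Lebesgue measure is determined by its values on boxes, and relabelling only permutes the
  side lengths. Compactness makes both sets Borel, where \<open>lebesgue\<close> and
  \<open>lborel\<close> agree.\<close>

lemma measure_reindex:
  fixes S :: "(real ^ 'a) set" and h :: "'b::finite \<Rightarrow> 'a"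
  assumes h: "bij h" and S: "compact S"
  shows "measure lebesgue (reindex h ` S) = measure lebesgue S"
proof -
  let ?g = "reindex (inv h) :: real ^ 'b \<Rightarrow> real ^ 'a"
  have meas: "?g \<in> borel_measurable lborel"
    using borel_measurable_continuous_onI[OF continuous_on_reindex] by simp
  have eq: "lborel = distr lborel borel ?g"
  proof (rule lborel_eqI)
    fix l u :: "real ^ 'a"
    assume le: "\<And>b. b \<in> Basis \<Longrightarrow> l \<bullet> b \<le> u \<bullet> b"
    have le': "l $ i \<le> u $ i" for i using le[of "axis i 1"] by (simp add: inner_axis)
    have "?g -` box l u = box (reindex h l) (reindex h u)"
      using h by (auto simp: mem_box_cart) (metis bij_inv_eq_iff)+
    then have "emeasure (distr lborel borel ?g) (box l u) =
        emeasure lborel (box (reindex h l) (reindex h u))"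
      using meas by (simp add: emeasure_distr)
    also have "\<dots> = (\<Prod>b\<in>Basis. (reindex h u - reindex h l) \<bullet> b)"
      using le' by (intro emeasure_lborel_box) (auto simp: Basis_vec_def inner_axis)
    also have "(\<Prod>b\<in>Basis. (reindex h u - reindex h l) \<bullet> b) = (\<Prod>j\<in>UNIV. u $ h j - l $ h j)"
      by (simp add: Basis_vec_def prod.UNION_disjoint axis_eq_axis inner_axis)
    also have "\<dots> = (\<Prod>i\<in>UNIV. u $ i - l $ i)"
      by (rule prod.reindex_bij_betw[OF h])
    also have "\<dots> = (\<Prod>b\<in>Basis. (u - l) \<bullet> b)"
      by (simp add: Basis_vec_def prod.UNION_disjoint axis_eq_axis inner_axis)
    finally show "emeasure (distr lborel borel ?g) (box l u) = (\<Prod>b\<in>Basis. (u - l) \<bullet> b)" .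
  qed simp
  have "measure lborel S = measure lborel (?g -` S)"
    using S meas by (subst eq) (simp add: measure_distr borel_compact)
  also have "?g -` S = reindex h ` S" by (rule reindex_image_eq_vimage[OF h, symmetric])
  finally show ?thesis
    using S compact_continuous_image[OF continuous_on_reindex S, of h] by (simp add: borel_compact measure_completion)
qed

lemma compact_ellipsoid: "ellipsoid E \<Longrightarrow> compact E"
  by (auto simp: ellipsoid_def intro!: compact_continuous_image continuous_on_add
      linear_continuous_on[OF matrix_vector_mul_bounded_linear])

text \<open>Relabelling rows and columns alike is multiplicative and fixes the identity, so it
  preserves invertibility. Reindexing is an isometry and maps ball to ball.\<close>

lemma ellipsoid_reindex:
  fixes E :: "(real ^ 'a) set" and h :: "'b::finite \<Rightarrow> 'a"
  assumes h: "bij h" and "ellipsoid E"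
  shows "ellipsoid (reindex h ` E)"
proof -
  define R where "R X = (\<chi> i j. X $ h i $ h j)" for X :: "real ^ 'a ^ 'a"
  have R_mult: "R X ** R Y = R (X ** Y)" for X Y
    using sum.reindex_bij_betw[OF h, of "\<lambda>k. X $ i $ k * Y $ k $ j" for i j]
    by (simp add: R_def matrix_matrix_mult_def vec_eq_iff)
  have R_vec: "R X *v reindex h v = reindex h (X *v v)" for X v
    using sum.reindex_bij_betw[OF h, of "\<lambda>k. X $ i $ k * v $ k" for i]
    by (simp add: R_def matrix_vector_mult_def vec_eq_iff)
  have R_1: "R (mat 1) = mat 1"
    using bij_is_inj[OF h] by (simp add: R_def mat_def vec_eq_iff inj_eq)
  obtain a and X :: "real ^ 'a ^ 'a" where X: "invertible X" "E = (\<lambda>v. a + X *v v) ` cball 0 1"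
    using assms(2) by (auto simp: ellipsoid_def)
  have "invertible (R X)"
    using X(1) R_1 R_mult unfolding invertible_def by metis
  moreover have "reindex h ` E = (\<lambda>v. reindex h a + R X *v v) ` reindex h ` cball 0 1"
    by (simp add: X(2) image_image R_vec linear_add[OF linear_reindex])
  moreover have "reindex h ` (cball 0 1 :: (real ^ 'a) set) = cball 0 1"
    using h norm_reindex[OF bij_imp_bij_inv[OF h]]
    by (auto simp: reindex_image_eq_vimage)
  ultimately show ?thesis by (auto simp: ellipsoid_def)
qed

lemma sees_linear_image:
  assumes "linear f" "sees K x y"
  shows "sees (f ` K) (f x) (f y)"
  unfolding sees_def closed_segment_linear_image[OF assms(1)]
  using assms(2) by (intro image_mono) (simp add: sees_def)


theorem theorem3p8:
  fixes K :: "(real ^ 'd) set"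
  assumes "compact K"
    and "\<And>p :: nat \<Rightarrow> real ^ 'd.
           (\<forall>i < CARD('d) * (CARD('d) + 3) div 2. p i \<in> K) \<Longrightarrow>
           \<exists>E. ellipsoid E \<and> measure lebesgue E = 1 \<and>
               (\<forall>x\<in>E. \<forall>i < CARD('d) * (CARD('d) + 3) div 2. sees K x (p i))"
  shows "\<exists>E. ellipsoid E \<and> measure lebesgue E = 1 \<and> (\<forall>x\<in>E. \<forall>y\<in>K. sees K x y)"
proof -
  define h :: "'d enumerated \<Rightarrow> 'd" where "h = Rep_enumerated"
  have h: "bij h"
    unfolding h_def
    by (rule o_bij[of Abs_enumerated]) (simp_all add: fun_eq_iff Rep_enumerated_inverse Abs_enumerated_inverse)
  then have h': "bij (inv h)" by (rule bij_imp_bij_inv)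
  have card: "CARD('d enumerated) = CARD('d)" using h by (rule bij_betw_same_card)
  note inv = reindex_inverse[OF h]
  define K' where "K' = reindex h ` K"
  have K: "K = reindex (inv h) ` K'" by (simp add: K'_def image_image inv)
  have "\<exists>E'. ellipsoid E' \<and> measure lebesgue E' = 1 \<and> (\<forall>x\<in>E'. \<forall>y\<in>K'. sees K' x y)"
  proof (rule kernel_ellipsoid_wellorder)
    show "compact K'"
      unfolding K'_def by (rule compact_continuous_image[OF continuous_on_reindex assms(1)])
    \<comment> \<open>The points are pulled back to \<open>K\<close>, where the hypothesis applies,
      and the ellipsoid obtained is pushed forward.\<close>
    fix p :: "nat \<Rightarrow> real ^ 'd enumerated"
    assume "\<forall>i < CARD('d enumerated) * (CARD('d enumerated) + 3) div 2. p i \<in> K'"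
    then have "\<forall>i < CARD('d) * (CARD('d) + 3) div 2. reindex (inv h) (p i) \<in> K"
      unfolding K card by blast
    then obtain E where E: "ellipsoid E" "measure lebesgue E = 1"
        "\<And>x i. x \<in> E \<Longrightarrow> i < CARD('d) * (CARD('d) + 3) div 2 \<Longrightarrow> sees K x (reindex (inv h) (p i))"
      using assms(2)[of "\<lambda>i. reindex (inv h) (p i)"] by blast
    have "sees K' (reindex h x) (p i)" if "x \<in> E" "i < CARD('d) * (CARD('d) + 3) div 2" for x i
      using sees_linear_image[OF linear_reindex E(3)[OF that], of h]
      by (simp add: K'_def inv)
    moreover have "measure lebesgue (reindex h ` E) = 1"
      using measure_reindex[OF h compact_ellipsoid[OF E(1)]] E(2) by simp
    ultimately show "\<exists>E'. ellipsoid E' \<and> measure lebesgue E' = 1 \<and>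
        (\<forall>x\<in>E'. \<forall>i < CARD('d enumerated) * (CARD('d enumerated) + 3) div 2. sees K' x (p i))"
      using ellipsoid_reindex[OF h E(1)] unfolding card by blast
  qed
  then obtain E' where E': "ellipsoid E'" "measure lebesgue E' = 1"
      "\<And>x y. x \<in> E' \<Longrightarrow> y \<in> K' \<Longrightarrow> sees K' x y" by blast
  have "sees K (reindex (inv h) x) y" if "x \<in> E'" "y \<in> K" for x y
  proof -
    have "sees K' x (reindex h y)" using that by (intro E'(3)) (auto simp: K'_def)
    then have "sees (reindex (inv h) ` K') (reindex (inv h) x) (reindex (inv h) (reindex h y))"
      by (rule sees_linear_image[OF linear_reindex])
    then show ?thesis by (simp only: inv flip: K)
  qed
  moreover have "measure lebesgue (reindex (inv h) ` E') = 1"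
    using measure_reindex[OF h' compact_ellipsoid[OF E'(1)]] E'(2) by simp
  ultimately show ?thesis
    using ellipsoid_reindex[OF h' E'(1)] by blast
qed

end
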